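(* Let $y(t)$ and $\{y_\lambda^n\}_{n\ge0}$ denote, respectively, the continuous solution and the SPIDeC numerical solution of the Dahlquist equation $y'(t)=\lambda y(t)$, $y(0)=1$, with $\lambda\in\mathbb{C}$, $\operatorname{Re}(\lambda)<0$. Then, for any $h>0$, $M\ge0$ and $N_k\ge0$, $$y_\lambda^n=\exp(nh\lambda)=y(t_n),\qquad n\ge0.$$ Consequently, the stability function of the SPIDeC scheme coincides with that of the continuous flow: $R(z)=\exp(z)$, $z=h\lambda$. In particular, $|R(z)|<1$ for all $\operatorname{Re}(z)<0$, so that the method is $A$-stable. Moreover, $\lim_{\operatorname{Re}(z)\to-\infty}|R(z)|=0$, so that the method is $L$-stable.
   Context: Let $t_n=nh$ with $h>0$, let $M,N_k\ge0$ be integers, let $0\le\tau_0<\tau_1<\dots<\tau_M=1$ be quadrature nodes with Lagrange basis polynomials $\ell_0,\dots,\ell_M$ (of degree at most $M$), and set $Q_{m,j}=\int_0^{\tau_m}\ell_j(\tau)\,d\tau$ for $m,j=0,\dots,M$. The SPIDeC scheme with $M+1$ stages and $N_k$ correction sweeps for a scalar equation $y'=f(y)$ is, for $m=0,\dots,M$, starting from $y^0=y(0)$: $$y^{n,m}_{(0)}=y^n\exp\Big(h\tau_m\frac{f(y^n)}{y^n}\Big),\qquad y^{n,m}_{(k)}=y^n\exp\Big(h\sum_{j=0}^M Q_{m,j}\frac{f(y^{n,j}_{(k-1)})}{y^{n,j}_{(k-1)}}\Big),\quad k=1,\dots,N_k,\qquad y^{n+1}=y^{n,M}_{(N_k)}.$$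 Here it is applied with $f(y)=\lambda y$ (complex-valued), and $y_\lambda^n$ denotes the resulting $y^n$. The stability function $R$ is defined by $y_\lambda^{n+1}=R(h\lambda)\,y_\lambda^n$. *)

theory Defs
  imports "HOL-Analysis.Analysis"
begin

definition quadrature_nodes :: "nat \<Rightarrow> (nat \<Rightarrow> real) \<Rightarrow> bool" where
  "quadrature_nodes M \<tau> \<longleftrightarrow> 0 \<le> \<tau> 0 \<and> strict_mono_on {0..M} \<tau> \<and> \<tau> M = 1"

definition lagrange_basis :: "nat \<Rightarrow> (nat \<Rightarrow> real) \<Rightarrow> nat \<Rightarrow> real \<Rightarrow> real" where
  "lagrange_basis M \<tau> j x = (\<Prod>i\<in>{0..M} - {j}. (x - \<tau> i) / (\<tau> j - \<tau> i))"

definition quad_weight :: "nat \<Rightarrow> (nat \<Rightarrow> real) \<Rightarrow> nat \<Rightarrow> nat \<Rightarrow> real" where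
  "quad_weight M \<tau> m j = integral {0..\<tau> m} (lagrange_basis M \<tau> j)"

text \<open>
  \<open>spidec_stage M \<tau> f h y k m\<close> is the value at node \<open>m\<close> after \<open>k\<close> correction sweeps within
  the step that starts from \<open>y\<close>. A vanishing denominator follows the convention \<open>x / 0 = 0\<close>.
\<close>

primrec spidec_stage ::
  "nat \<Rightarrow> (nat \<Rightarrow> real) \<Rightarrow> (complex \<Rightarrow> complex) \<Rightarrow> real \<Rightarrow> complex \<Rightarrow> nat \<Rightarrow> nat \<Rightarrow> complex" where
  "spidec_stage M \<tau> f h y 0 =
     (\<lambda>m. y * exp (of_real h * of_real (\<tau> m) * (f y / y)))"
| "spidec_stage M \<tau> f h y (Suc k) =
     (\<lambda>m. y * exp (of_real h *
        (\<Sum>j=0..M. of_real (quad_weight M \<tau> m j) *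
           (f (spidec_stage M \<tau> f h y k j) / spidec_stage M \<tau> f h y k j))))"

primrec spidec ::
  "nat \<Rightarrow> (nat \<Rightarrow> real) \<Rightarrow> nat \<Rightarrow> (complex \<Rightarrow> complex) \<Rightarrow> complex \<Rightarrow> real \<Rightarrow> nat \<Rightarrow> complex" where
  "spidec M \<tau> N f y0 h 0 = y0"
| "spidec M \<tau> N f y0 h (Suc n) = spidec_stage M \<tau> f h (spidec M \<tau> N f y0 h n) N M"

definition spidec_dahlquist ::
  "nat \<Rightarrow> (nat \<Rightarrow> real) \<Rightarrow> nat \<Rightarrow> complex \<Rightarrow> real \<Rightarrow> nat \<Rightarrow> complex" where
  "spidec_dahlquist M \<tau> N lam h = spidec M \<tau> N (\<lambda>y. lam * y) 1 h"

definition dahlquist_solution :: "complex \<Rightarrow> (real \<Rightarrow> complex) \<Rightarrow> bool" where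
  "dahlquist_solution lam y \<longleftrightarrow>
     y 0 = 1 \<and> (\<forall>t\<ge>0. (y has_vector_derivative lam * y t) (at t within {0..}))"

text \<open>
  \<open>Y lam h n\<close> is the \<open>n\<close>-th iterate with step size \<open>h\<close> for the Dahlquist equation with parameter
  \<open>lam\<close>. One function \<open>R\<close> of the product \<open>h * lam\<close> has to serve all step sizes and all \<open>lam\<close>; as usual
  it is defined on the whole complex plane.
\<close>

definition is_stability_function ::
  "(complex \<Rightarrow> real \<Rightarrow> nat \<Rightarrow> complex) \<Rightarrow> (complex \<Rightarrow> complex) \<Rightarrow> bool" where
  "is_stability_function Y R \<longleftrightarrow>
     (\<forall>lam h n. 0 < h \<longrightarrow> Y lam h (Suc n) = R (of_real h * lam) * Y lam h n)"

definition stability_region :: "(complex \<Rightarrow> complex) \<Rightarrow> complex set" where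
  "stability_region R = {z. cmod (R z) < 1}"

definition A_stable :: "(complex \<Rightarrow> complex) \<Rightarrow> bool" where
  "A_stable R \<longleftrightarrow> {z. Re z < 0} \<subseteq> stability_region R"

text \<open>
  The limit is taken for \<open>Re z \<rightarrow> -\<infinity>\<close>, uniformly in \<open>Im z\<close>; for \<open>\<bar>z\<bar> \<rightarrow> \<infinity>\<close> in the whole plane it
  would fail for the exponential function.
\<close>

definition L_stable :: "(complex \<Rightarrow> complex) \<Rightarrow> bool" where
  "L_stable R \<longleftrightarrow> A_stable R \<and> ((\<lambda>z. cmod (R z)) \<longlongrightarrow> 0) (filtercomap Re at_bot)"

end

theory Submission
  imports Defs
begin

text \<open>
  For the Dahlquist equation the quotient \<open>f y / y\<close>, which is all that the scheme ever sees of \<open>f\<close>,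
  is the constant \<open>lam\<close>. Every quadrature in a correction sweep is therefore applied to a constant,
  and interpolatory quadrature integrates constants exactly: the Lagrange basis is a partition of
  unity (\<open>sum_lagrange_basis\<close>), so the weights of row \<open>m\<close> add up to \<open>\<tau> m\<close>
  (\<open>sum_quad_weight\<close>). Hence the exponential predictor \<open>y * exp (h * \<tau> m * lam)\<close> is a fixed point of
  the sweep, whatever the number of sweeps (\<open>spidec_stage_linear\<close>), and since \<open>\<tau> M = 1\<close> one step is
  multiplication by \<open>exp (h * lam)\<close>. This is the exact flow, so everything
  about the stability function is a property of the exponential, mainly
  \<open>cmod (exp z) = exp (Re z)\<close>. The stability function is determined on the whole plane because
  every \<open>z\<close> arises as \<open>h * lam\<close> with \<open>h = 1\<close>, and the first step from the initial value \<open>1\<close> then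
  forces \<open>R z = exp z\<close> (\<open>is_stability_function_exp_iff\<close>).
\<close>

lemma lagrange_basis_at_node:
  assumes "inj_on \<tau> {0..M}" "j \<le> M" "k \<le> M"
  shows "lagrange_basis M \<tau> j (\<tau> k) = (if j = k then 1 else 0)"
proof (cases "j = k")
  case True
  have "(\<tau> k - \<tau> i) / (\<tau> k - \<tau> i) = 1" if "i \<in> {0..M} - {k}" for i
    using that assms by (auto dest: inj_onD)
  then show ?thesis
    using True by (simp add: lagrange_basis_def)
next
  case False
  then show ?thesis
    using assms(3) by (auto simp: lagrange_basis_def intro!: prod_zero)
qed

text \<open>
  The difference of the two sides is a polynomial in \<open>x\<close> of degree at most \<open>M\<close> that
  vanishes at the \<open>M + 1\<close> nodes.
\<close>

lemma sum_lagrange_basis: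
  assumes inj: "inj_on \<tau> {0..M}"
  shows "(\<Sum>j=0..M. lagrange_basis M \<tau> j x) = 1"
proof -
  define p where "p j = (\<Prod>i\<in>{0..M} - {j}. smult (1 / (\<tau> j - \<tau> i)) [:- \<tau> i, 1:])" for j
  have poly_p: "poly (p j) t = lagrange_basis M \<tau> j t" for j t
    by (simp add: p_def poly_prod lagrange_basis_def diff_divide_distrib)
  have degree_p: "degree (p j) \<le> M" if "j \<in> {0..M}" for j
  proof -
    have "degree (p j) \<le> (\<Sum>i\<in>{0..M} - {j}. degree (smult (1 / (\<tau> j - \<tau> i)) [:- \<tau> i, 1:]))"
      unfolding p_def by (rule degree_prod_sum_le[unfolded o_def]) simp
    also have "\<dots> \<le> (\<Sum>i\<in>{0..M} - {j}. 1)"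
      by (intro sum_mono order_trans[OF degree_smult_le]) simp
    also have "\<dots> = M"
      using that by simp
    finally show ?thesis .
  qed
  have "(\<Sum>j=0..M. p j) = 1"
  proof (rule poly_eqI_degree[of "\<tau> ` {0..M}"])
    show "poly (\<Sum>j=0..M. p j) t = poly 1 t" if "t \<in> \<tau> ` {0..M}" for t
      using that inj by (auto simp: poly_sum poly_p lagrange_basis_at_node)
    have "degree (\<Sum>j=0..M. p j) \<le> M"
      by (rule degree_sum_le) (use degree_p in auto)
    then show "degree (\<Sum>j=0..M. p j) < card (\<tau> ` {0..M})"
      by (simp add: card_image[OF inj])
  qed (simp add: card_image[OF inj])
  then have "poly (\<Sum>j=0..M. p j) x = 1"
    by simp
  then show ?thesis
    by (simp add: poly_sum poly_p)
qed

lemma lagrange_basis_integrable: "lagrange_basis M \<tau> j integrable_on {a..b}"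
proof -
  have "continuous_on {a..b} (lagrange_basis M \<tau> j)"
    unfolding lagrange_basis_def divide_inverse by (intro continuous_intros)
  then show ?thesis
    by (rule integrable_continuous_interval)
qed

lemma sum_quad_weight:
  assumes "inj_on \<tau> {0..M}" "0 \<le> \<tau> m"
  shows "(\<Sum>j=0..M. quad_weight M \<tau> m j) = \<tau> m"
proof -
  have "(\<Sum>j=0..M. quad_weight M \<tau> m j)
      = integral {0..\<tau> m} (\<lambda>x. \<Sum>j=0..M. lagrange_basis M \<tau> j x)"
    unfolding quad_weight_def
    by (rule integral_sum[symmetric]) (auto intro: lagrange_basis_integrable)
  also have "\<dots> = \<tau> m"
    using assms by (simp add: sum_lagrange_basis)
  finally show ?thesis .
qed

lemma quadrature_nodes_inj: "quadrature_nodes M \<tau> \<Longrightarrow> inj_on \<tau> {0..M}"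
  unfolding quadrature_nodes_def by (blast intro: strict_mono_on_imp_inj_on)

lemma quadrature_nodes_nonneg:
  assumes "quadrature_nodes M \<tau>" "m \<le> M"
  shows "0 \<le> \<tau> m"
proof -
  have "strict_mono_on {0..M} \<tau>"
    using assms(1) by (simp add: quadrature_nodes_def)
  then have "\<tau> 0 \<le> \<tau> m"
    by (rule strict_mono_on_leD) (use assms(2) in auto)
  then show ?thesis
    using assms(1) by (simp add: quadrature_nodes_def)
qed

text \<open>
  The assumption \<open>y \<noteq> 0\<close> is what makes all quotients \<open>lam * u / u\<close> equal to \<open>lam\<close>: each stage
  value is \<open>y\<close> times an exponential.
\<close>

lemma spidec_stage_linear:
  assumes nodes: "quadrature_nodes M \<tau>" and "y \<noteq> 0" "m \<le> M"
  shows "spidec_stage M \<tau> (\<lambda>u. lam * u) h y k m = y * exp (of_real h * of_real (\<tau> m) * lam)"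
  using \<open>m \<le> M\<close>
proof (induction k arbitrary: m)
  case 0
  show ?case
    using \<open>y \<noteq> 0\<close> by simp
next
  case (Suc k)
  have "(\<Sum>j=0..M. complex_of_real (quad_weight M \<tau> m j) *
           (lam * spidec_stage M \<tau> (\<lambda>u. lam * u) h y k j / spidec_stage M \<tau> (\<lambda>u. lam * u) h y k j))
      = (\<Sum>j=0..M. of_real (quad_weight M \<tau> m j) * lam)"
    using \<open>y \<noteq> 0\<close> by (intro sum.cong) (auto simp: Suc.IH)
  also have "\<dots> = of_real (\<Sum>j=0..M. quad_weight M \<tau> m j) * lam"
    by (simp add: sum_distrib_right)
  also have "\<dots> = of_real (\<tau> m) * lam"
    using nodes Suc.prems
    by (simp add: sum_quad_weight quadrature_nodes_inj quadrature_nodes_nonneg)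
  finally show ?case
    by (simp add: mult.assoc)
qed

lemma spidec_dahlquist_eq_exp:
  assumes "quadrature_nodes M \<tau>"
  shows "spidec_dahlquist M \<tau> N lam h n = exp (of_nat n * of_real h * lam)"
proof (induction n)
  case 0
  show ?case
    by (simp add: spidec_dahlquist_def)
next
  case (Suc n)
  have "\<tau> M = 1"
    using assms by (simp add: quadrature_nodes_def)
  then have "spidec_dahlquist M \<tau> N lam h (Suc n)
      = exp (of_nat n * of_real h * lam) * exp (of_real h * lam)"
    using spidec_stage_linear[OF assms, of "exp (of_nat n * of_real h * lam)" M lam h N] Suc.IH
    by (simp add: spidec_dahlquist_def)
  also have "\<dots> = exp (of_nat n * of_real h * lam + of_real h * lam)"
    by (rule mult_exp_exp)
  also have "of_nat n * of_real h * lam + of_real h * lam = of_nat (Suc n) * of_real h * lam"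
    by (simp add: algebra_simps)
  finally show ?case .
qed

text \<open>Uniqueness for the linear equation: \<open>y t * exp (- lam * t)\<close> has derivative zero.\<close>

lemma dahlquist_solution_eq_exp:
  assumes sol: "dahlquist_solution lam y" and "0 \<le> t"
  shows "y t = exp (of_real t * lam)"
proof -
  define g where "g s = y s * exp (s *\<^sub>R (- lam))" for s :: real
  have "(g has_vector_derivative 0) (at s within {0..})" if "s \<in> {0..}" for s
  proof -
    have "(y has_vector_derivative lam * y s) (at s within {0..})"
      using sol that by (simp add: dahlquist_solution_def)
    from has_vector_derivative_mult[OF this exp_scaleR_has_vector_derivative_right[of "- lam"]]
    show ?thesis
      unfolding g_def by (rule has_vector_derivative_eq_rhs) (simp add: algebra_simps)
  qed
  then obtain c where c: "\<And>s. s \<in> {0..} \<Longrightarrow> g s = c"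
    using has_vector_derivative_zero_constant[of "{0..}" g] by auto
  have "g t = g 0"
    using c \<open>0 \<le> t\<close> by simp
  also have "\<dots> = 1"
    using sol by (simp add: g_def dahlquist_solution_def)
  finally show ?thesis
    by (simp add: g_def scaleR_conv_of_real exp_minus divide_simps)
qed

text \<open>
  Stated for any method whose iterates lie on the exact solution, so that it applies both to the
  scheme and to the continuous flow sampled at the grid points.
\<close>

lemma is_stability_function_exp_iff:
  assumes "\<And>lam h n. 0 < h \<Longrightarrow> Y lam h n = exp (of_nat n * of_real h * lam)"
  shows "is_stability_function Y R \<longleftrightarrow> R = exp"
proof
  assume R: "is_stability_function Y R"
  show "R = exp"
  proof
    fix z
    have "Y z 1 (Suc 0) = R (of_real 1 * z) * Y z 1 0"
      using R unfolding is_stability_function_def by (metis zero_less_one)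
    then show "R z = exp z"
      by (simp add: assms)
  qed
next
  assume "R = exp"
  then show "is_stability_function Y R"
    by (simp add: is_stability_function_def assms mult_exp_exp ring_distribs)
qed

lemma A_stable_exp: "A_stable exp"
  by (auto simp: A_stable_def stability_region_def)

lemma cmod_exp_tendsto_0_Re_at_bot: "((\<lambda>z. cmod (exp z)) \<longlongrightarrow> 0) (filtercomap Re at_bot)"
  unfolding norm_exp_eq_Re by (rule filterlim_compose[OF exp_at_bot filterlim_filtercomap])

theorem theorem5p1:
  fixes M N :: nat and \<tau> :: "nat \<Rightarrow> real"
  assumes nodes: "quadrature_nodes M \<tau>"
  shows "(\<forall>(lam::complex) (h::real) (n::nat). Re lam < 0 \<longrightarrow> 0 < h \<longrightarrow>
            spidec_dahlquist M \<tau> N lam h n = exp (of_nat n * of_real h * lam) \<and>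
            (\<forall>y. dahlquist_solution lam y \<longrightarrow>
               exp (of_nat n * of_real h * lam) = y (real n * h)))
       \<and> (\<exists>!R. is_stability_function (spidec_dahlquist M \<tau> N) R)
       \<and> (\<forall>R. is_stability_function (spidec_dahlquist M \<tau> N) R \<longrightarrow>
            (\<forall>\<phi>. (\<forall>lam. dahlquist_solution lam (\<phi> lam)) \<longrightarrow>
               is_stability_function (\<lambda>lam h n. \<phi> lam (real n * h)) R)
          \<and> (\<forall>z. R z = exp z)
          \<and> (\<forall>z. Re z < 0 \<longrightarrow> cmod (R z) < 1)
          \<and> A_stable R
          \<and> ((\<lambda>z. cmod (R z)) \<longlongrightarrow> 0) (filtercomap Re at_bot)
          \<and> L_stable R)"
proof -
  have flow: "y (real n * h) = exp (of_nat n * of_real h * lam)"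
    if "dahlquist_solution lam y" "0 < h" for lam y h n
    using dahlquist_solution_eq_exp[OF that(1), of "real n * h"] that(2) by simp
  have scheme: "is_stability_function (spidec_dahlquist M \<tau> N) R \<longleftrightarrow> R = exp" for R
    by (intro is_stability_function_exp_iff spidec_dahlquist_eq_exp nodes)
  have "is_stability_function (\<lambda>lam h n. \<phi> lam (real n * h)) exp"
    if "\<forall>lam. dahlquist_solution lam (\<phi> lam)" for \<phi>
    using that by (subst is_stability_function_exp_iff) (auto intro: flow)
  then show ?thesis
    using A_stable_exp cmod_exp_tendsto_0_Re_at_bot
    by (auto simp: scheme spidec_dahlquist_eq_exp[OF nodes] flow L_stable_def)
qed

end
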